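(* Let $\Omega$ be a simply connected domain in $\mathbb{C}$ with $0\notin\Omega$. Let $\mathcal{S}_t(\Omega)$ be the set of all $f\in\mathcal{H}ol(\Omega)$ with the property that for every $c\in\mathbb{C}$ there exists a sequence $\{\lambda_n\}$ in $\{0,1,2,\dots\}$ such that for every compact set $L\subset\Omega$, $\sup_{\zeta\in L}|\widetilde{T}_{\lambda_n}(f)(\zeta)-c|\to 0$ as $n\to\infty$. Then $\mathcal{S}_t(\Omega)$ contains a dense $G_\delta$ set in $\mathcal{H}ol(\Omega)$.
   Context: A domain is an open connected subset of $\mathbb{C}$. $\mathcal{H}ol(\Omega)$ is the space of all holomorphic functions on $\Omega$ with the topology of uniform convergence on compact subsets of $\Omega$. A $G_\delta$ set is a countable intersection of open sets. For each integer $N\ge 0$, $\widetilde{T}_N:\mathcal{H}ol(\Omega)\to\mathcal{H}ol(\Omega)$ is defined by $\widetilde{T}_N(f)(\zeta)=\sum_{n=0}^{N}\frac{f^{(n)}(\zeta)}{n!}(-\zeta)^n$ for $\zeta\in\Omega$. *)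

theory Defs
  imports "HOL-Complex_Analysis.Complex_Analysis"
begin

text \<open>
  Elements of \<open>Hol \<Omega>\<close> are functions on \<open>\<Omega>\<close>, encoded as total functions with a fixed value
  outside \<open>\<Omega>\<close>, so that functions agreeing on \<open>\<Omega>\<close> are equal.
\<close>

definition Hol :: "complex set \<Rightarrow> (complex \<Rightarrow> complex) set" where
  "Hol \<Omega> = {f. f \<in> extensional \<Omega> \<and> f holomorphic_on \<Omega>}"

text \<open>
  The topology of uniform convergence on compact subsets: the sets
  \<open>{g \<in> Hol \<Omega>. \<forall>z\<in>K. dist (f z) (g z) < e}\<close> form a neighbourhood base at \<open>f\<close>.
\<close>

definition Hol_topology :: "complex set \<Rightarrow> (complex \<Rightarrow> complex) topology" where
  "Hol_topology \<Omega> = topology (\<lambda>U. U \<subseteq> Hol \<Omega> \<and>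
     (\<forall>f\<in>U. \<exists>K e. compact K \<and> K \<subseteq> \<Omega> \<and> e > 0 \<and>
        {g \<in> Hol \<Omega>. \<forall>z\<in>K. dist (f z) (g z) < e} \<subseteq> U))"

lemma openin_Hol_topology:
  "openin (Hol_topology \<Omega>) U \<longleftrightarrow> U \<subseteq> Hol \<Omega> \<and>
     (\<forall>f\<in>U. \<exists>K e. compact K \<and> K \<subseteq> \<Omega> \<and> e > 0 \<and>
        {g \<in> Hol \<Omega>. \<forall>z\<in>K. dist (f z) (g z) < e} \<subseteq> U)"
proof -
  let ?O = "\<lambda>U. U \<subseteq> Hol \<Omega> \<and>
     (\<forall>f\<in>U. \<exists>K e. compact K \<and> K \<subseteq> \<Omega> \<and> e > 0 \<and>
        {g \<in> Hol \<Omega>. \<forall>z\<in>K. dist (f z) (g z) < e} \<subseteq> U)"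
  have "istopology ?O"
    unfolding istopology_def
  proof (intro conjI allI impI)
    fix S T assume S: "?O S" and T: "?O T"
    show "S \<inter> T \<subseteq> Hol \<Omega>" using S by blast
    show "\<forall>f\<in>S \<inter> T. \<exists>K e. compact K \<and> K \<subseteq> \<Omega> \<and> e > 0 \<and>
        {g \<in> Hol \<Omega>. \<forall>z\<in>K. dist (f z) (g z) < e} \<subseteq> S \<inter> T"
    proof
      fix f assume "f \<in> S \<inter> T"
      then have "f \<in> S" "f \<in> T" by auto
      from bspec[OF conjunct2[OF S] \<open>f \<in> S\<close>] obtain K e where
        K: "compact K" "K \<subseteq> \<Omega>" "e > 0" "{g \<in> Hol \<Omega>. \<forall>z\<in>K. dist (f z) (g z) < e} \<subseteq> S"
        by (elim exE conjE)
      from bspec[OF conjunct2[OF T] \<open>f \<in> T\<close>] obtain K' e' where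
        K': "compact K'" "K' \<subseteq> \<Omega>" "e' > 0" "{g \<in> Hol \<Omega>. \<forall>z\<in>K'. dist (f z) (g z) < e'} \<subseteq> T"
        by (elim exE conjE)
      have "{g \<in> Hol \<Omega>. \<forall>z\<in>K \<union> K'. dist (f z) (g z) < min e e'} \<subseteq> S \<inter> T"
        using K(4) K'(4) by auto
      with K K' show "\<exists>K e. compact K \<and> K \<subseteq> \<Omega> \<and> e > 0 \<and>
          {g \<in> Hol \<Omega>. \<forall>z\<in>K. dist (f z) (g z) < e} \<subseteq> S \<inter> T"
        by (intro exI[of _ "K \<union> K'"] exI[of _ "min e e'"] conjI) (simp_all add: compact_Un)
    qed
  next
    fix \<K> assume K: "\<forall>S\<in>\<K>. ?O S"
    show "\<Union>\<K> \<subseteq> Hol \<Omega>" using K by blast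
    show "\<forall>f\<in>\<Union>\<K>. \<exists>K e. compact K \<and> K \<subseteq> \<Omega> \<and> e > 0 \<and>
        {g \<in> Hol \<Omega>. \<forall>z\<in>K. dist (f z) (g z) < e} \<subseteq> \<Union>\<K>"
    proof
      fix f assume "f \<in> \<Union>\<K>"
      then obtain S where "S \<in> \<K>" "f \<in> S" by blast
      from K \<open>S \<in> \<K>\<close> have "?O S" by (rule bspec)
      from bspec[OF conjunct2[OF this] \<open>f \<in> S\<close>] obtain K e where
        K: "compact K" "K \<subseteq> \<Omega>" "e > 0" "{g \<in> Hol \<Omega>. \<forall>z\<in>K. dist (f z) (g z) < e} \<subseteq> S"
        by (elim exE conjE)
      from K(4) Union_upper[OF \<open>S \<in> \<K>\<close>]
      have "{g \<in> Hol \<Omega>. \<forall>z\<in>K. dist (f z) (g z) < e} \<subseteq> \<Union>\<K>" by (rule order_trans)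
      with K(1-3) show "\<exists>K e. compact K \<and> K \<subseteq> \<Omega> \<and> e > 0 \<and>
          {g \<in> Hol \<Omega>. \<forall>z\<in>K. dist (f z) (g z) < e} \<subseteq> \<Union>\<K>"
        by (intro exI conjI)
    qed
  qed
  then show ?thesis
    by (simp add: Hol_topology_def topology_inverse')
qed

lemma topspace_Hol_topology [simp]: "topspace (Hol_topology \<Omega>) = Hol \<Omega>"
proof -
  have "openin (Hol_topology \<Omega>) (Hol \<Omega>)"
    unfolding openin_Hol_topology
    by (intro conjI ballI exI[of _ "{}"] exI[of _ "1::real"]) auto
  moreover have "U \<subseteq> Hol \<Omega>" if "openin (Hol_topology \<Omega>) U" for U
    using that by (simp add: openin_Hol_topology)
  ultimately show ?thesis
    unfolding topspace_def by blast
qed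

text \<open>The value at \<open>0\<close> of the \<open>N\<close>-th Taylor polynomial of \<open>f\<close> centred at \<open>\<zeta>\<close>.\<close>

definition T_tilde ::
    "complex set \<Rightarrow> nat \<Rightarrow> (complex \<Rightarrow> complex) \<Rightarrow> complex \<Rightarrow> complex" where
  "T_tilde \<Omega> N f =
     (\<lambda>\<zeta>\<in>\<Omega>. \<Sum>n=0..N. (deriv ^^ n) f \<zeta> / fact n * (- \<zeta>) ^ n)"

lemma T_tilde_in_Hol:
  assumes "open \<Omega>" "f \<in> Hol \<Omega>"
  shows "T_tilde \<Omega> N f \<in> Hol \<Omega>"
proof -
  have "(\<lambda>\<zeta>. \<Sum>n=0..N. (deriv ^^ n) f \<zeta> / fact n * (- \<zeta>) ^ n) holomorphic_on \<Omega>"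
    using assms by (intro holomorphic_intros holomorphic_higher_deriv) (auto simp: Hol_def)
  then have "T_tilde \<Omega> N f holomorphic_on \<Omega>"
    by (rule holomorphic_transform) (simp add: T_tilde_def)
  then show ?thesis
    by (simp add: Hol_def T_tilde_def)
qed

definition S_t :: "complex set \<Rightarrow> (complex \<Rightarrow> complex) set" where
  "S_t \<Omega> = {f \<in> Hol \<Omega>. \<forall>c. \<exists>l :: nat \<Rightarrow> nat. \<forall>L. compact L \<and> L \<subseteq> \<Omega> \<longrightarrow>
     uniform_limit L (\<lambda>n. T_tilde \<Omega> (l n) f) (\<lambda>_. c) sequentially}"

end

theory Submission
  imports Defs
begin

text \<open>
  If \<open>p\<close> is a polynomial of degree at most \<open>N\<close>, its \<open>N\<close>-th Taylor polynomial about any centre is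
  \<open>p\<close> itself, so \<open>T_tilde \<Omega> N p\<close> is the constant \<open>p(0)\<close>. Polynomials are dense in \<open>Hol \<Omega>\<close> by Runge's
  theorem, and since \<open>0 \<notin> \<Omega>\<close> so are the polynomials with a prescribed value at \<open>0\<close>. Hence for each
  compact set, each target \<open>c\<close> and each tolerance, the functions some transform of which is close to
  \<open>c\<close> form a dense open set, and Baire's argument applies to countably many of these.

  For Runge's theorem, let \<open>\<phi>\<close> be a Riemann map from the unit disc onto \<open>\<Omega>\<close>. The image \<open>L\<close> of a smaller
  closed disc has connected complement, which allows pole pushing. Cauchy's formula for the
  function \<open>v \<mapsto> f(\<phi> v) \<phi>'(v) (v - u) / (\<phi> v - \<phi> u)\<close> on a circle writes \<open>f\<close> on \<open>L\<close> as an integral of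
  functions with one simple pole off \<open>L\<close>, without any winding number argument along the image curve.
\<close>

subsection \<open>Uniform approximation by polynomials\<close>

definition poly_approx :: "complex set \<Rightarrow> (complex \<Rightarrow> complex) \<Rightarrow> bool" where
  "poly_approx K h \<longleftrightarrow> (\<forall>e>0. \<exists>p. \<forall>z\<in>K. norm (h z - poly p z) < e)"

lemma poly_approxD:
  assumes "poly_approx K h" "e > 0"
  obtains p where "\<And>z. z \<in> K \<Longrightarrow> norm (h z - poly p z) < e"
  using assms unfolding poly_approx_def by blast

lemma poly_approx_subset: "poly_approx K h \<Longrightarrow> L \<subseteq> K \<Longrightarrow> poly_approx L h"
  unfolding poly_approx_def by (meson subsetD)

lemma poly_approx_cong:
  assumes "\<And>z. z \<in> K \<Longrightarrow> h z = k z"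
  shows "poly_approx K h \<longleftrightarrow> poly_approx K k"
  using assms unfolding poly_approx_def by simp

lemma poly_approx_poly: "poly_approx K (poly p)"
  unfolding poly_approx_def by (intro allI impI exI[of _ p]) simp

lemma poly_approx_const: "poly_approx K (\<lambda>_. c)"
  using poly_approx_poly[of K "[:c:]"] by (simp add: poly_approx_def)

lemma poly_approx_ident: "poly_approx K (\<lambda>z. z)"
  using poly_approx_poly[of K "[:0, 1:]"] by (simp add: poly_approx_def)

text \<open>With this closure property it suffices to find approximable functions near
  \<open>h\<close>, not polynomials; products, geometric series and integrals are all handled this
  way.\<close>

lemma poly_approx_uniform_limit:
  assumes "\<And>e. e > 0 \<Longrightarrow> \<exists>k. poly_approx K k \<and> (\<forall>z\<in>K. norm (h z - k z) < e)"
  shows "poly_approx K h"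
  unfolding poly_approx_def
proof (intro allI impI)
  fix e :: real assume "e > 0"
  then obtain k where k: "poly_approx K k" "\<forall>z\<in>K. norm (h z - k z) < e/2"
    using assms[of "e/2"] by auto
  obtain p where p: "\<And>z. z \<in> K \<Longrightarrow> norm (k z - poly p z) < e/2"
    using poly_approxD[OF k(1) half_gt_zero[OF \<open>e > 0\<close>]] by blast
  have "norm (h z - poly p z) < e" if "z \<in> K" for z
    using norm_diff_triangle_less[OF k(2)[rule_format, OF that] p[OF that]] by simp
  then show "\<exists>p. \<forall>z\<in>K. norm (h z - poly p z) < e" by blast
qed

lemma poly_approx_add:
  assumes "poly_approx K h" "poly_approx K k"
  shows "poly_approx K (\<lambda>z. h z + k z)"
  unfolding poly_approx_def
proof (intro allI impI)
  fix e :: real assume "e > 0"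
  then have "e/2 > 0" by simp
  obtain p where p: "\<And>z. z \<in> K \<Longrightarrow> norm (h z - poly p z) < e/2"
    using poly_approxD[OF assms(1) \<open>e/2 > 0\<close>] by blast
  obtain q where q: "\<And>z. z \<in> K \<Longrightarrow> norm (k z - poly q z) < e/2"
    using poly_approxD[OF assms(2) \<open>e/2 > 0\<close>] by blast
  have "norm (h z + k z - poly (p + q) z) < e" if "z \<in> K" for z
    using norm_add_less[OF p[OF that] q[OF that]] by (simp add: algebra_simps)
  then show "\<exists>p. \<forall>z\<in>K. norm (h z + k z - poly p z) < e" by blast
qed

lemma poly_approx_bounded:
  assumes "compact K" "poly_approx K h"
  obtains B where "B > 0" "\<And>z. z \<in> K \<Longrightarrow> norm (h z) \<le> B"
proof -
  obtain p where p: "\<And>z. z \<in> K \<Longrightarrow> norm (h z - poly p z) < 1"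
    using poly_approxD[OF assms(2), of 1] by auto
  have "compact (poly p ` K)"
    by (intro compact_continuous_image continuous_intros assms)
  then obtain b where b: "\<And>z. z \<in> K \<Longrightarrow> norm (poly p z) \<le> b"
    by (metis bounded_iff compact_imp_bounded imageI)
  show thesis
  proof
    fix z assume "z \<in> K"
    show "norm (h z) \<le> \<bar>b\<bar> + 1"
      using p[OF \<open>z \<in> K\<close>] b[OF \<open>z \<in> K\<close>] norm_triangle_sub[of "h z" "poly p z"] by linarith
  qed auto
qed

lemma poly_approx_mult:
  assumes "compact K" "poly_approx K h" "poly_approx K k"
  shows "poly_approx K (\<lambda>z. h z * k z)"
proof -
  obtain B where B: "B > 0" "\<And>z. z \<in> K \<Longrightarrow> norm (h z) \<le> B"
    using poly_approx_bounded[OF assms(1,2)] by blast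
  \<comment> \<open>The factors are replaced one at a time. Against a fixed polynomial
    \<open>q\<close> the bound \<open>C\<close> on \<open>K\<close> is known before the tolerance
    \<open>e / C\<close> for \<open>h\<close> is chosen; afterwards \<open>k\<close> is replaced by
    \<open>q\<close>, using the bound \<open>B\<close> of \<open>h\<close>.\<close>
  have poly_mult: "poly_approx K (\<lambda>z. h z * poly q z)" for q
    unfolding poly_approx_def
  proof (intro allI impI)
    fix e :: real assume "e > 0"
    obtain C where C: "C > 0" "\<And>z. z \<in> K \<Longrightarrow> norm (poly q z) \<le> C"
      using poly_approx_bounded[OF assms(1) poly_approx_poly] by blast
    obtain p where p: "\<And>z. z \<in> K \<Longrightarrow> norm (h z - poly p z) < e / C"
      using poly_approxD[OF assms(2) divide_pos_pos[OF \<open>e > 0\<close> C(1)]] by blast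
    have "norm (h z * poly q z - poly (p * q) z) < e" if "z \<in> K" for z
    proof -
      have "norm (h z * poly q z - poly (p * q) z) = norm (h z - poly p z) * norm (poly q z)"
        by (simp add: norm_mult[symmetric] algebra_simps)
      also have "\<dots> \<le> norm (h z - poly p z) * C"
        using C(2)[OF that] by (intro mult_left_mono) auto
      also have "\<dots> < e"
        using p[OF that] C(1) by (simp add: field_simps)
      finally show ?thesis .
    qed
    then show "\<exists>p. \<forall>z\<in>K. norm (h z * poly q z - poly p z) < e" by blast
  qed
  show ?thesis
  proof (rule poly_approx_uniform_limit)
    fix e :: real assume "e > 0"
    obtain q where q: "\<And>z. z \<in> K \<Longrightarrow> norm (k z - poly q z) < e / B"
      using poly_approxD[OF assms(3) divide_pos_pos[OF \<open>e > 0\<close> B(1)]] by blast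
    have "norm (h z * k z - h z * poly q z) < e" if "z \<in> K" for z
    proof -
      have "norm (h z * k z - h z * poly q z) = norm (h z) * norm (k z - poly q z)"
        by (simp add: norm_mult[symmetric] algebra_simps)
      also have "\<dots> \<le> B * norm (k z - poly q z)"
        using B(2)[OF that] by (intro mult_right_mono) auto
      also have "\<dots> < e"
        using q[OF that] B(1) by (simp add: field_simps)
      finally show ?thesis .
    qed
    with poly_mult show "\<exists>k'. poly_approx K k' \<and> (\<forall>z\<in>K. norm (h z * k z - k' z) < e)"
      by blast
  qed
qed

lemma poly_approx_power:
  assumes "compact K" "poly_approx K h"
  shows "poly_approx K (\<lambda>z. h z ^ n)"
  by (induction n) (auto intro: poly_approx_const poly_approx_mult assms)

lemma poly_approx_sum:
  fixes n :: nat
  assumes "\<And>i. i < n \<Longrightarrow> poly_approx K (h i)"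
  shows "poly_approx K (\<lambda>z. \<Sum>i<n. h i z)"
  using assms by (induction n) (auto intro: poly_approx_const poly_approx_add)

section \<open>Geometric series and pole pushing\<close>

text \<open>The partial sums of the geometric series in \<open>h\<close> are approximable, and their
  remainder \<open>h z ^ n / (1 - h z)\<close> is at most \<open>q ^ n / (1 - q)\<close>, uniformly
  on \<open>K\<close>.\<close>

lemma poly_approx_inverse_one_minus:
  assumes "compact K" "poly_approx K h" "q < 1" "\<And>z. z \<in> K \<Longrightarrow> norm (h z) \<le> q"
  shows "poly_approx K (\<lambda>z. 1 / (1 - h z))"
proof (cases "K = {}")
  case True
  then show ?thesis by (simp add: poly_approx_def)
next
  case False
  \<comment> \<open>Only a nonempty \<open>K\<close> forces this sign, hence the case split.\<close>
  have "q \<ge> 0"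
    using False assms(4) norm_ge_zero order_trans by blast
  show ?thesis
  proof (rule poly_approx_uniform_limit)
    fix e :: real assume "e > 0"
    have "(\<lambda>n. q ^ n / (1 - q)) \<longlonglongrightarrow> 0 / (1 - q)"
      using \<open>q \<ge> 0\<close> \<open>q < 1\<close> by (intro tendsto_intros LIMSEQ_power_zero) auto
    then obtain n where n: "q ^ n / (1 - q) < e"
      using order_tendstoD(2)[of _ "0 / (1 - q)" sequentially e] \<open>e > 0\<close>
      by (auto simp: eventually_sequentially)
    have "norm (1 / (1 - h z) - (\<Sum>i<n. h z ^ i)) < e" if "z \<in> K" for z
    proof -
      have hz: "norm (h z) \<le> q" using assms(4) that .
      have ne: "h z \<noteq> 1" using hz \<open>q < 1\<close> by auto
      have lb: "1 - q \<le> norm (1 - h z)"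
        using hz norm_triangle_ineq2[of 1 "h z"] by simp
      have "1 / (1 - h z) - (\<Sum>i<n. h z ^ i) = h z ^ n / (1 - h z)"
        using ne by (simp add: geometric_sum field_simps)
      then have "norm (1 / (1 - h z) - (\<Sum>i<n. h z ^ i)) = norm (h z) ^ n / norm (1 - h z)"
        by (simp add: norm_divide norm_power)
      also have "\<dots> \<le> q ^ n / (1 - q)"
        using lb hz \<open>q < 1\<close> \<open>q \<ge> 0\<close> by (intro frac_le power_mono) auto
      finally show ?thesis using n by simp
    qed
    then show "\<exists>k. poly_approx K k \<and> (\<forall>z\<in>K. norm (1 / (1 - h z) - k z) < e)"
      by (intro exI[of _ "\<lambda>z. \<Sum>i<n. h z ^ i"] conjI poly_approx_sum poly_approx_power assms) auto
  qed
qed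

text \<open>For a pole \<open>w0\<close> of modulus \<open>2 * R\<close> the quotient
  \<open>z / w0\<close> has norm at most 1/2 on \<open>K\<close>, so a geometric series applies. The
  property then spreads over the connected set \<open>- K\<close>, because it passes between any two
  poles that are close together compared with their distance from \<open>K\<close>.\<close>

lemma poly_approx_inverse_linear:
  assumes "compact K" "connected (- K)" "w \<notin> K"
  shows "poly_approx K (\<lambda>z. 1 / (z - w))"
proof (cases "K = {}")
  case True
  then show ?thesis by (simp add: poly_approx_def)
next
  case False
  obtain R where R: "R > 0" "\<And>z. z \<in> K \<Longrightarrow> norm z \<le> R"
    using compact_imp_bounded[OF assms(1)] bounded_pos by metis
  define w0 :: complex where "w0 = of_real (2 * R)"
  have nw0: "norm w0 = 2 * R" using R(1) by (simp add: w0_def)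
  have w0: "w0 \<in> - K" using R nw0 by force
  have start: "poly_approx K (\<lambda>z. 1 / (z - w0))"
  proof -
    have "poly_approx K (\<lambda>z. 1 / (1 - z / w0))"
    proof (rule poly_approx_inverse_one_minus[OF assms(1), of _ "1/2"])
      show "poly_approx K (\<lambda>z. z / w0)"
        using poly_approx_mult[OF assms(1) poly_approx_ident poly_approx_const[of K "1 / w0"]]
        by simp
    qed (use R nw0 in \<open>auto simp: norm_divide field_simps\<close>)
    then have "poly_approx K (\<lambda>z. (- 1 / w0) * (1 / (1 - z / w0)))"
      by (intro poly_approx_mult[OF assms(1)] poly_approx_const)
    moreover have "(- 1 / w0) * (1 / (1 - z / w0)) = 1 / (z - w0)" if "z \<in> K" for z
    proof -
      have "z \<noteq> w0" "w0 \<noteq> 0" using that w0 nw0 R(1) by auto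
      then show ?thesis by (simp add: divide_simps)
    qed
    ultimately show ?thesis by (subst (asm) poly_approx_cong)
  qed
  show ?thesis
  proof (rule connected_induction_simple[OF assms(2), where a = w0])
    fix a assume a: "a \<in> - K"
    define d where "d = infdist a K"
    have d: "d > 0"
      using a False compact_imp_closed[OF assms(1)] infdist_pos_not_in_closed d_def by fastforce
    \<comment> \<open>With radius \<open>d/3\<close>, two points \<open>x\<close>, \<open>y\<close>
      of the ball are less than \<open>2*d/3\<close> apart, while every \<open>z\<close> in
      \<open>K\<close> is at least \<open>2*d/3\<close> away from \<open>x\<close>. So
      \<open>(y - x) / (z - x)\<close> is bounded by some \<open>q < 1\<close>, and
      \<open>1 / (z - y)\<close> is \<open>1 / (z - x)\<close> times a geometric series in this
      quotient.\<close>
    have ball: "ball a (d/3) \<subseteq> - K"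
    proof
      fix x assume "x \<in> ball a (d/3)"
      moreover have "d \<le> dist a x" if "x \<in> K"
        unfolding d_def using that by (rule infdist_le)
      ultimately show "x \<in> - K" using d by auto
    qed
    have step: "poly_approx K (\<lambda>z. 1 / (z - y))"
      if x: "x \<in> ball a (d/3)" and y: "y \<in> ball a (d/3)"
        and px: "poly_approx K (\<lambda>z. 1 / (z - x))" for x y
    proof -
      have yx: "norm (y - x) \<le> dist a x + dist a y"
        by (metis dist_commute dist_norm dist_triangle add.commute)
      define q where "q = norm (y - x) / (d * 2/3)"
      have "q < 1" using yx x y d by (simp add: q_def field_simps)
      have far: "norm (z - x) \<ge> d * 2/3" if "z \<in> K" for z
      proof -
        have "d \<le> dist a z" unfolding d_def using that by (rule infdist_le)
        moreover have "dist a z \<le> dist a x + dist x z" by (rule dist_triangle)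
        ultimately show ?thesis using x by (simp add: dist_norm norm_minus_commute)
      qed
      have "poly_approx K (\<lambda>z. 1 / (1 - (y - x) * (1 / (z - x))))"
      proof (rule poly_approx_inverse_one_minus[OF assms(1) _ \<open>q < 1\<close>])
        show "poly_approx K (\<lambda>z. (y - x) * (1 / (z - x)))"
          by (intro poly_approx_mult[OF assms(1)] poly_approx_const px)
        show "norm ((y - x) * (1 / (z - x))) \<le> q" if "z \<in> K" for z
          unfolding q_def using far[OF that] d
          by (simp only: norm_mult norm_divide times_divide_eq_right mult_1_right norm_one, intro frac_le) auto
      qed
      then have "poly_approx K (\<lambda>z. (1 / (z - x)) * (1 / (1 - (y - x) * (1 / (z - x)))))"
        by (intro poly_approx_mult[OF assms(1)] px)
      moreover have "(1 / (z - x)) * (1 / (1 - (y - x) * (1 / (z - x)))) = 1 / (z - y)"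
        if "z \<in> K" for z
      proof -
        have "z \<noteq> x" "z \<noteq> y" using that x y ball by auto
        then show ?thesis by (simp add: divide_simps)
      qed
      ultimately show ?thesis by (subst (asm) poly_approx_cong)
    qed
    show "\<exists>T. openin (top_of_set (- K)) T \<and> a \<in> T \<and>
        (\<forall>x\<in>T. \<forall>y\<in>T. poly_approx K (\<lambda>z. 1 / (z - x)) \<longrightarrow> poly_approx K (\<lambda>z. 1 / (z - y)))"
    proof (intro exI conjI ballI impI)
      show "openin (top_of_set (- K)) (ball a (d/3))"
        using ball by (intro open_subset) auto
      show "a \<in> ball a (d/3)" using d by simp
    qed (rule step)
  qed (use w0 assms start in auto)
qed

section \<open>Integration over a parameter\<close>

text \<open>Left-endpoint Riemann sums are finite combinations of the functions \<open>F t\<close>,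
  hence approximable. Uniform continuity on the compact product makes them converge to the integral
  uniformly in \<open>z\<close>.\<close>

lemma poly_approx_integral:
  fixes F :: "real \<Rightarrow> complex \<Rightarrow> complex"
  assumes "compact K" and cont: "continuous_on ({0..1} \<times> K) (\<lambda>(t, z). F t z)"
    and approx: "\<And>t. t \<in> {0..1} \<Longrightarrow> poly_approx K (F t)"
  shows "poly_approx K (\<lambda>z. integral {0..1} (\<lambda>t. F t z))"
proof (rule poly_approx_uniform_limit)
  fix e :: real assume "e > 0"
  have "uniformly_continuous_on ({0..1} \<times> K) (\<lambda>(t, z). F t z)"
    by (intro compact_uniformly_continuous cont compact_Times assms) auto
  then obtain d where d: "d > 0" and
    close: "\<And>x y. x \<in> {0..1} \<times> K \<Longrightarrow> y \<in> {0..1} \<times> K \<Longrightarrow> dist y x < d \<Longrightarrow>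
      dist ((\<lambda>(t, z). F t z) y) ((\<lambda>(t, z). F t z) x) < e/2"
    unfolding uniformly_continuous_on_def using \<open>e > 0\<close> by (metis half_gt_zero)
  have close': "norm (F s z - F t z) \<le> e/2"
    if "s \<in> {0..1}" "t \<in> {0..1}" "\<bar>s - t\<bar> < d" "z \<in> K" for s t z
    using close[of "(t, z)" "(s, z)"] that by (simp add: dist_Pair_Pair dist_norm)
  obtain n where n: "n > 0" "1 / real n < d"
    using d by (metis nat_approx_posE inverse_eq_divide zero_less_Suc)
  define k where "k = (\<lambda>z. \<Sum>i<n. F (i / n) z * of_real (1 / n))"
  have pk: "poly_approx K k"
    unfolding k_def using \<open>n > 0\<close>
    by (intro poly_approx_sum poly_approx_mult[OF assms(1)] approx poly_approx_const) auto
  have "norm (integral {0..1} (\<lambda>t. F t z) - k z) \<le> e/2" if z: "z \<in> K" for z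
  proof -
    have contz: "continuous_on {0..1} (\<lambda>t. F t z)"
      using z by (intro continuous_on_compose2[OF cont, of _ "\<lambda>t. (t, z)", simplified] continuous_intros) auto
    have int: "(\<lambda>t. F t z) integrable_on {a..b}" if "0 \<le> a" "b \<le> 1" for a b
      using that by (intro integrable_continuous_interval continuous_on_subset[OF contz]) auto
    \<comment> \<open>Induction over the first \<open>m\<close> subintervals: each adds an error of
      at most \<open>e/2 * (1/n)\<close>, so the whole interval costs at most
      \<open>e/2\<close>.\<close>
    have "norm (integral {0..m / n} (\<lambda>t. F t z) - (\<Sum>i<m. F (i / n) z * of_real (1 / n))) \<le> e/2 * (m / n)"
      if "m \<le> n" for m :: nat
      using that
    proof (induction m)
      case (Suc m)
      define a b where "a = m / real n" and "b = Suc m / real n"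
      have ab: "0 \<le> a" "a \<le> b" "b \<le> 1" "b - a = 1 / n"
        using Suc.prems \<open>n > 0\<close> by (auto simp: a_def b_def field_simps)
      have split: "integral {0..b} (\<lambda>t. F t z) = integral {0..a} (\<lambda>t. F t z) + integral {a..b} (\<lambda>t. F t z)"
        using ab int by (intro Henstock_Kurzweil_Integration.integral_combine[symmetric]) auto
      have "integral {a..b} (\<lambda>t. F t z) - F a z * of_real (1/n) = integral {a..b} (\<lambda>t. F t z - F a z)"
        using ab int
        by (subst integral_diff) (auto simp: scaleR_conv_of_real mult.commute)
      also have "norm \<dots> \<le> e/2 * (b - a)"
      proof (rule integral_bound)
        show "continuous_on {a..b} (\<lambda>t. F t z - F a z)"
          using ab by (intro continuous_intros continuous_on_subset[OF contz]) auto
        show "norm (F t z - F a z) \<le> e/2" if "t \<in> {a..b}" for t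
          using ab n z that by (intro close') auto
      qed (use ab in auto)
      finally have "norm (integral {a..b} (\<lambda>t. F t z) - F a z * of_real (1/n)) \<le> e/2 * (1/n)"
        using ab by simp
      moreover have "norm (integral {0..a} (\<lambda>t. F t z) - (\<Sum>i<m. F (i / n) z * of_real (1 / n))) \<le> e/2 * a"
        using Suc by (simp add: a_def)
      ultimately have "norm ((integral {0..a} (\<lambda>t. F t z) - (\<Sum>i<m. F (i / n) z * of_real (1 / n)))
          + (integral {a..b} (\<lambda>t. F t z) - F a z * of_real (1/n))) \<le> e/2 * a + e/2 * (1/n)"
        by (intro norm_triangle_mono)
      also have "e/2 * a + e/2 * (1/n) = e/2 * b"
        using ab by (simp add: field_simps)
      also have "(integral {0..a} (\<lambda>t. F t z) - (\<Sum>i<m. F (i / n) z * of_real (1 / n)))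
          + (integral {a..b} (\<lambda>t. F t z) - F a z * of_real (1/n))
          = integral {0..b} (\<lambda>t. F t z) - (\<Sum>i<Suc m. F (i / n) z * of_real (1 / n))"
        unfolding split by (simp add: a_def)
      finally show ?case unfolding b_def .
    qed auto
    from this[of n] show ?thesis using \<open>n > 0\<close> by (simp add: k_def)
  qed
  with pk \<open>e > 0\<close> show "\<exists>k. poly_approx K k \<and> (\<forall>z\<in>K. norm (integral {0..1} (\<lambda>t. F t z) - k z) < e)"
    by (intro exI[of _ k]) force
qed

subsection \<open>Runge approximation\<close>

lemma poly_approx_holomorphic_simply_connected:
  assumes "open \<Omega>" "simply_connected \<Omega>" "\<Omega> \<noteq> UNIV" "f holomorphic_on \<Omega>"
    and "compact K" "K \<subseteq> \<Omega>"
  shows "poly_approx K f"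
proof (cases "K = {}")
  case True
  then show ?thesis by (simp add: poly_approx_def)
next
  case False
  then have "\<Omega> \<noteq> {}" using assms by auto
  then obtain \<psi> \<phi> where \<psi>: "\<psi> holomorphic_on \<Omega>" and \<phi>: "\<phi> holomorphic_on ball 0 1"
    and \<psi>\<phi>: "\<And>z. z \<in> \<Omega> \<Longrightarrow> \<psi> z \<in> ball 0 1 \<and> \<phi> (\<psi> z) = z"
    and \<phi>\<psi>: "\<And>z. z \<in> ball 0 1 \<Longrightarrow> \<phi> z \<in> \<Omega> \<and> \<psi> (\<phi> z) = z"
    using assms(1-3) Riemann_mapping_theorem[of \<Omega>] by metis
  have inj: "inj_on \<phi> (ball 0 1)"
    using \<phi>\<psi> by (metis inj_onI)
  have cont\<psi>: "continuous_on K (\<lambda>z. norm (\<psi> z))"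
    using \<psi> \<open>K \<subseteq> \<Omega>\<close> by (intro continuous_on_norm) (meson continuous_on_subset holomorphic_on_imp_continuous_on)
  obtain z0 where z0: "z0 \<in> K" "\<And>z. z \<in> K \<Longrightarrow> norm (\<psi> z) \<le> norm (\<psi> z0)"
    using continuous_attains_sup[OF \<open>compact K\<close> False cont\<psi>] by blast
  \<comment> \<open>The closed disc of radius \<open>s\<close> contains the image of
    \<open>K\<close> under \<open>\<psi>\<close>. The radius \<open>r\<close>, midway between
    \<open>s\<close> and 1, is that of the contour, which therefore avoids this disc but stays in
    the unit disc.\<close>
  define s where "s = norm (\<psi> z0)"
  define r where "r = (1 + s) / 2"
  have s: "0 \<le> s" "s < 1" using \<psi>\<phi> z0 \<open>K \<subseteq> \<Omega>\<close> by (auto simp: s_def)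
  then have r: "0 < r" "s < r" "r < 1" by (auto simp: r_def)
  \<comment> \<open>The complement of \<open>K\<close> itself may be disconnected. \<open>L\<close>
    contains \<open>K\<close> and is homeomorphic to a closed disc, so poles can be pushed in its
    complement.\<close>
  define L where "L = \<phi> ` cball 0 s"
  have sub: "cball 0 s \<subseteq> ball (0::complex) 1" using s by auto
  have cont\<phi>: "continuous_on (ball 0 1) \<phi>" using \<phi> by (rule holomorphic_on_imp_continuous_on)
  have KL: "K \<subseteq> L"
  proof
    fix z assume "z \<in> K"
    then have "\<psi> z \<in> cball 0 s" "z = \<phi> (\<psi> z)" using z0 \<psi>\<phi> \<open>K \<subseteq> \<Omega>\<close> by (auto simp: s_def)
    then show "z \<in> L" unfolding L_def by (metis imageI)
  qed
  have cL: "compact L"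
    unfolding L_def using cont\<phi> sub by (intro compact_continuous_image) (auto intro: continuous_on_subset)
  have "cball (0::complex) s homeomorphic L"
    unfolding L_def using cont\<phi> sub inj
    by (intro homeomorphic_compact[where f = \<phi>]) (auto intro: continuous_on_subset inj_on_subset)
  then have "L homeomorphic cball (0::complex) s" by (rule homeomorphic_sym[THEN iffD1])
  then have "connected (- L)"
    by (rule connected_complement_homeomorphic_convex_compact) auto
  define \<gamma> where "\<gamma> = circlepath (0::complex) r"
  have \<gamma>: "norm (\<gamma> t) = r" "\<gamma> t \<in> ball 0 1" for t
    using r by (auto simp: \<gamma>_def circlepath norm_mult)
  have notL: "\<phi> (\<gamma> t) \<notin> L" for t
  proof
    assume "\<phi> (\<gamma> t) \<in> L"
    then obtain u where "u \<in> cball 0 s" "\<phi> (\<gamma> t) = \<phi> u" by (auto simp: L_def)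
    then have "\<gamma> t = u" using inj \<gamma>(2)[of t] sub by (meson inj_onD subsetD)
    then show False using \<open>u \<in> cball 0 s\<close> \<gamma>(1)[of t] r by auto
  qed
  \<comment> \<open>\<open>F t z\<close> is the integrand of Cauchy's formula for \<open>f\<close>
    along the image of \<open>\<gamma>\<close> under \<open>\<phi>\<close>, pulled back to the unit
    interval. \<open>A\<close> collects the factors free of \<open>z\<close>; its last one is the
    velocity of the circle \<open>\<gamma>\<close>.\<close>
  define A where "A t = f (\<phi> (\<gamma> t)) * deriv \<phi> (\<gamma> t) * (2 * pi * \<i> * r * exp (2 * of_real pi * \<i> * t))"
    for t :: real
  define F where "F t z = A t / (\<phi> (\<gamma> t) - z)" for t z
  have cont\<gamma>: "continuous_on {0..1} \<gamma>"
    using path_circlepath[of 0 r] by (simp add: path_def \<gamma>_def)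
  have f\<phi>: "(\<lambda>v. f (\<phi> v)) holomorphic_on ball 0 1"
    using holomorphic_on_compose_gen[OF \<phi> assms(4), unfolded o_def] \<phi>\<psi> by blast
  have d\<phi>: "deriv \<phi> holomorphic_on ball 0 1"
    using \<phi> by (intro holomorphic_deriv) auto
  have comp: "continuous_on {0..1} (\<lambda>t. h (\<gamma> t))" if "h holomorphic_on ball 0 1" for h
    using \<gamma>(2) by (intro continuous_on_compose2[OF holomorphic_on_imp_continuous_on[OF that] cont\<gamma>]) auto
  have contA: "continuous_on {0..1} A"
    unfolding A_def using comp[OF f\<phi>] comp[OF d\<phi>] by (intro continuous_intros) auto
  have approx: "poly_approx L (\<lambda>z. integral {0..1} (\<lambda>t. F t z))"
  proof (rule poly_approx_integral[OF cL])
    have "continuous_on ({0..1} \<times> L) (\<lambda>x. A (fst x) / (\<phi> (\<gamma> (fst x)) - snd x))"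
      using notL
      by (intro continuous_intros continuous_on_compose2[OF contA] continuous_on_compose2[OF comp[OF \<phi>]]) auto
    then show "continuous_on ({0..1} \<times> L) (\<lambda>(t, z). F t z)"
      by (simp add: F_def case_prod_beta)
  next
    fix t
    have "poly_approx L (\<lambda>z. - A t * (1 / (z - \<phi> (\<gamma> t))))"
      by (intro poly_approx_mult[OF cL] poly_approx_const
          poly_approx_inverse_linear[OF cL \<open>connected (- L)\<close> notL])
    moreover have "- A t * (1 / (z - \<phi> (\<gamma> t))) = F t z" for z
      unfolding F_def by (metis minus_diff_eq minus_divide_left minus_divide_right mult.right_neutral times_divide_eq_right)
    ultimately show "poly_approx L (F t)" by simp
  qed
  have Cauchy: "integral {0..1} (\<lambda>t. F t z) = 2 * of_real pi * \<i> * f z" if z: "z \<in> L" for z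
  proof -
    obtain u where u: "u \<in> cball 0 s" "z = \<phi> u" using z by (auto simp: L_def)
    \<comment> \<open>The difference quotient of \<open>\<phi>\<close> at \<open>u\<close> with its
      removable singularity filled in. It is holomorphic, and injectivity of \<open>\<phi>\<close>
      keeps it free of zeros, including at \<open>u\<close>, where its value is the
      derivative.\<close>
    define D where "D v = (if v = u then deriv \<phi> u else (\<phi> v - \<phi> u) / (v - u))" for v
    have u1: "u \<in> ball 0 1" using u sub by auto
    have D: "D holomorphic_on ball 0 1"
      unfolding D_def using pole_lemma[OF \<phi>, of u] u1 by simp
    have D0: "D v \<noteq> 0" if "v \<in> ball 0 1" for v
      using that u1 inj holomorphic_injective_imp_regular[OF \<phi> open_ball inj u1]
      by (auto simp: D_def dest: inj_onD)
    \<comment> \<open>Dividing by \<open>D\<close> turns the kernel \<open>1 / (v - u)\<close> into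
      \<open>1 / (\<phi> v - \<phi> u)\<close> on the circle, while at \<open>u\<close> the
      derivative cancels and leaves \<open>f z\<close>. Cauchy's formula for \<open>h\<close> on a
      round circle thus gives the formula for \<open>f\<close>.\<close>
    define h where "h v = f (\<phi> v) * deriv \<phi> v / D v" for v
    have h: "h holomorphic_on ball 0 1"
      unfolding h_def using f\<phi> \<phi> D D0 by (intro holomorphic_intros) auto
    have hu: "h u = f z"
      using D0[OF u1] u by (simp add: h_def D_def)
    have "((\<lambda>v. h v / (v - u)) has_contour_integral (2 * of_real pi * \<i> * h u)) (circlepath 0 r)"
    proof (rule Cauchy_integral_circlepath)
      show "continuous_on (cball 0 r) h" "h holomorphic_on ball 0 r"
        using h r by (auto intro!: holomorphic_on_imp_continuous_on elim!: holomorphic_on_subset)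
      show "norm (u - 0) < r" using u r by auto
    qed
    then have "((\<lambda>t. h (\<gamma> t) / (\<gamma> t - u) * vector_derivative \<gamma> (at t within {0..1}))
        has_integral (2 * of_real pi * \<i> * h u)) {0..1}"
      by (simp add: has_contour_integral_def \<gamma>_def)
    also have "?this \<longleftrightarrow> ((\<lambda>t. F t z) has_integral (2 * of_real pi * \<i> * h u)) {0..1}"
    proof (rule has_integral_cong)
      fix t :: real assume t: "t \<in> {0..1}"
      have ne: "\<gamma> t \<noteq> u" using \<gamma>(1)[of t] u r by auto
      have ne2: "\<phi> (\<gamma> t) \<noteq> \<phi> u" using notL[of t] u z by auto
      have "h (\<gamma> t) / (\<gamma> t - u) = f (\<phi> (\<gamma> t)) * deriv \<phi> (\<gamma> t) / (\<phi> (\<gamma> t) - \<phi> u)"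
        using ne ne2 by (simp add: h_def D_def)
      moreover have "vector_derivative \<gamma> (at t within {0..1}) = 2 * pi * \<i> * r * exp (2 * of_real pi * \<i> * t)"
        using t by (simp add: \<gamma>_def vector_derivative_circlepath01)
      ultimately show "h (\<gamma> t) / (\<gamma> t - u) * vector_derivative \<gamma> (at t within {0..1}) = F t z"
        by (simp add: F_def A_def u(2))
    qed
    finally show ?thesis using hu by (simp add: integral_unique)
  qed
  have "poly_approx L (\<lambda>z. (1 / (2 * of_real pi * \<i>)) * integral {0..1} (\<lambda>t. F t z))"
    by (intro poly_approx_mult[OF cL] poly_approx_const approx)
  also have "?this \<longleftrightarrow> poly_approx L f"
    using Cauchy by (intro poly_approx_cong) simp
  finally show ?thesis using KL poly_approx_subset by blast
qed

subsection \<open>Taylor polynomials evaluated at the origin\<close>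

text \<open>The Taylor series of \<open>p\<close> about \<open>\<zeta>\<close>, evaluated at 0, sums
  to \<open>poly p 0\<close>. Its terms beyond \<open>N\<close> vanish, so the truncated sum has the
  same value.\<close>

lemma T_tilde_poly:
  assumes "open \<Omega>" "\<zeta> \<in> \<Omega>" "degree p \<le> N" "f \<in> Hol \<Omega>" "\<And>z. z \<in> \<Omega> \<Longrightarrow> f z = poly p z"
  shows "T_tilde \<Omega> N f \<zeta> = poly p 0"
proof -
  have deriv: "(deriv ^^ n) (poly p) = poly ((pderiv ^^ n) p)" for n
  proof (induction n)
    case (Suc n)
    then show ?case using poly_DERIV by (auto intro!: ext DERIV_imp_deriv)
  qed simp
  \<comment> \<open>Agreement of \<open>f\<close> and \<open>p\<close> on the open set
    \<open>\<Omega>\<close> suffices for equality of all derivatives there.\<close>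
  have "(deriv ^^ n) f \<zeta> = (deriv ^^ n) (poly p) \<zeta>" for n
    using assms by (intro higher_deriv_transform_within_open[of _ \<Omega>]) (auto simp: Hol_def intro: holomorphic_intros)
  then have eq: "T_tilde \<Omega> N f \<zeta> = (\<Sum>n=0..N. (deriv ^^ n) (poly p) \<zeta> / fact n * (0 - \<zeta>) ^ n)"
    using assms(2) by (simp add: T_tilde_def)
  have "(\<lambda>n. (deriv ^^ n) (poly p) \<zeta> / fact n * (0 - \<zeta>) ^ n) sums poly p 0"
    by (rule holomorphic_power_series[of _ _ "norm \<zeta> + 1"]) (auto intro: holomorphic_intros simp: dist_norm)
  moreover have "(\<lambda>n. (deriv ^^ n) (poly p) \<zeta> / fact n * (0 - \<zeta>) ^ n) sums
      (\<Sum>n=0..N. (deriv ^^ n) (poly p) \<zeta> / fact n * (0 - \<zeta>) ^ n)"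
  proof (rule sums_finite)
    fix n assume "n \<notin> {0..N}"
    then have "(pderiv ^^ n) p = 0"
      using assms(3) by (intro poly_eqI) (simp add: coeff_higher_pderiv coeff_eq_0)
    then show "(deriv ^^ n) (poly p) \<zeta> / fact n * (0 - \<zeta>) ^ n = 0"
      by (simp add: deriv)
  qed auto
  ultimately show ?thesis
    unfolding eq by (rule sums_unique2[symmetric])
qed

text \<open>Continuity of the \<open>N\<close>-th transform: Cauchy's inequality on discs of radius
  \<open>r\<close> about points of \<open>K\<close> controls the derivatives of \<open>f - g\<close>
  by the size of \<open>f - g\<close> on \<open>L\<close>, the closed \<open>r\<close>-neighbourhood
  of \<open>K\<close>.\<close>

lemma T_tilde_continuous:
  assumes "open \<Omega>" "compact K" "K \<subseteq> \<Omega>" "e > 0"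
  obtains L d where "compact L" "L \<subseteq> \<Omega>" "d > 0"
    "\<And>f g z. \<lbrakk>f \<in> Hol \<Omega>; g \<in> Hol \<Omega>; \<And>z. z \<in> L \<Longrightarrow> dist (f z) (g z) < d; z \<in> K\<rbrakk> \<Longrightarrow>
      dist (T_tilde \<Omega> N f z) (T_tilde \<Omega> N g z) < e"
proof -
  obtain r where r: "r > 0" "(\<Union>x\<in>K. cball x r) \<subseteq> \<Omega>"
    using compact_subset_open_imp_cball_epsilon_subset[OF assms(2,1,3)] by blast
  define L where "L = {x + y |x y. x \<in> K \<and> y \<in> cball 0 r}"
  have cL: "compact L"
    unfolding L_def by (intro compact_sums assms) auto
  have L: "cball x r \<subseteq> L" if "x \<in> K" for x
  proof
    fix w assume "w \<in> cball x r"
    then have "w = x + (w - x)" "w - x \<in> cball 0 r" by (auto simp: dist_norm norm_minus_commute)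
    then show "w \<in> L" unfolding L_def using that by blast
  qed
  have "x + y \<in> cball x r" if "y \<in> cball 0 r" for x y :: complex
    using that by (simp add: dist_norm norm_minus_commute)
  then have L\<Omega>: "L \<subseteq> \<Omega>" unfolding L_def using r(2) by blast
  obtain R where R: "R > 0" "\<And>z. z \<in> K \<Longrightarrow> norm z \<le> R"
    using compact_imp_bounded[OF assms(2)] bounded_pos by metis
  \<comment> \<open>The \<open>n\<close>-th term of the transform of \<open>f - g\<close> is at most
    \<open>d * (R / r) ^ n\<close>: Cauchy's inequality gives \<open>d / r ^ n\<close>, and
    \<open>norm z ^ n\<close> is at most \<open>R ^ n\<close>.\<close>
  define M where "M = (\<Sum>n=0..N. (R / r) ^ n)"
  have M: "M \<ge> 0" unfolding M_def using R r by (intro sum_nonneg) auto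
  define d where "d = e / (M + 1)"
  have d: "d > 0" "d * M < e"
    using M \<open>e > 0\<close> by (auto simp: d_def field_simps)
  show thesis
  proof (rule that[OF cL L\<Omega> d(1)])
    fix f g z
    assume f: "f \<in> Hol \<Omega>" and g: "g \<in> Hol \<Omega>" and fg: "\<And>z. z \<in> L \<Longrightarrow> dist (f z) (g z) < d"
      and z: "z \<in> K"
    have z\<Omega>: "z \<in> \<Omega>" using z assms by auto
    have hol: "f holomorphic_on \<Omega>" "g holomorphic_on \<Omega>" using f g by (auto simp: Hol_def)
    have sub: "cball z r \<subseteq> \<Omega>" using r(2) z by auto
    have bound: "norm ((deriv ^^ n) f z - (deriv ^^ n) g z) \<le> fact n * d / r ^ n" for n
    proof -
      have "norm ((deriv ^^ n) (\<lambda>w. f w - g w) z) \<le> fact n * d / r ^ n"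
      proof (rule Cauchy_inequality)
        show "(\<lambda>w. f w - g w) holomorphic_on ball z r"
          using sub ball_subset_cball by (intro holomorphic_intros) (blast intro: hol[THEN holomorphic_on_subset])+
        show "continuous_on (cball z r) (\<lambda>w. f w - g w)"
          using sub by (intro holomorphic_on_imp_continuous_on holomorphic_intros) (blast intro: hol[THEN holomorphic_on_subset])+
        show "norm (f x - g x) \<le> d" if "norm (z - x) = r" for x
          using fg[of x] L[OF z] that by (force simp: dist_norm)
      qed (rule r)
      then show ?thesis using higher_deriv_diff[OF hol assms(1) z\<Omega>] by simp
    qed
    have "dist (T_tilde \<Omega> N f z) (T_tilde \<Omega> N g z)
        = norm (\<Sum>n=0..N. ((deriv ^^ n) f z - (deriv ^^ n) g z) / fact n * (- z) ^ n)"
      using z\<Omega> by (simp add: T_tilde_def dist_norm sum_subtractf[symmetric] left_diff_distrib diff_divide_distrib)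
    also have "\<dots> \<le> (\<Sum>n=0..N. d * (R / r) ^ n)"
    proof (rule sum_norm_le)
      fix n
      have "norm (((deriv ^^ n) f z - (deriv ^^ n) g z) / fact n * (- z) ^ n)
          = norm ((deriv ^^ n) f z - (deriv ^^ n) g z) / fact n * norm z ^ n"
        by (simp add: norm_mult norm_divide norm_power)
      also have "\<dots> \<le> (fact n * d / r ^ n) / fact n * R ^ n"
        using bound[of n] R(2)[OF z] R(1) d(1) r(1)
        by (intro mult_mono divide_right_mono power_mono) auto
      also have "\<dots> = d * (R / r) ^ n"
        by (simp add: power_divide)
      finally show "norm (((deriv ^^ n) f z - (deriv ^^ n) g z) / fact n * (- z) ^ n) \<le> d * (R / r) ^ n" .
    qed
    also have "\<dots> = d * M" by (simp add: M_def sum_distrib_left)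
    finally show "dist (T_tilde \<Omega> N f z) (T_tilde \<Omega> N g z) < e" using d(2) by simp
  qed
qed

text \<open>A polynomial approximation of \<open>1 / z\<close> gives a polynomial \<open>1 - z r(z)\<close> that is small on
  \<open>K\<close> and equals \<open>1\<close> at \<open>0\<close>; adding a multiple of it corrects the value at \<open>0\<close>.\<close>

lemma Hol_poly_approx_value_at_0:
  assumes "open \<Omega>" "simply_connected \<Omega>" "0 \<notin> \<Omega>" "g \<in> Hol \<Omega>" "compact K" "K \<subseteq> \<Omega>" "e > 0"
  obtains p where "poly p 0 = c" "\<And>z. z \<in> K \<Longrightarrow> dist (g z) (poly p z) < e"
proof -
  have "\<Omega> \<noteq> UNIV" using assms(3) by auto
  note runge = poly_approx_holomorphic_simply_connected[OF assms(1,2) this _ assms(5,6)]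
  have "poly_approx K g" using runge assms(4) by (simp add: Hol_def)
  then obtain p0 where p0: "\<And>z. z \<in> K \<Longrightarrow> norm (g z - poly p0 z) < e / 2"
    using poly_approxD[OF _ half_gt_zero[OF \<open>e > 0\<close>]] by blast
  define a where "a = c - poly p0 0"
  obtain R where R: "R > 0" "\<And>z. z \<in> K \<Longrightarrow> norm z \<le> R"
    using compact_imp_bounded[OF assms(5)] bounded_pos by metis
  \<comment> \<open>Scaled so that the correction \<open>a * z * (1 / z - poly q z)\<close> has norm
    at most \<open>e / 2\<close> on \<open>K\<close>; the summand 1 keeps the denominator positive
    when \<open>a = 0\<close>.\<close>
  define d where "d = e / 2 / (R * (norm a + 1))"
  have "d > 0" using \<open>e > 0\<close> R(1) by (auto simp: d_def intro!: divide_pos_pos mult_pos_pos add_nonneg_pos)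
  have "poly_approx K (\<lambda>z. 1 / z)"
    using assms(3) by (intro runge holomorphic_intros) auto
  then obtain q where q: "\<And>z. z \<in> K \<Longrightarrow> norm (1 / z - poly q z) < d"
    using poly_approxD[OF _ \<open>d > 0\<close>] by blast
  define p where "p = p0 + smult a (1 - pCons 0 q)"
  show thesis
  proof (rule that[of p])
    show "poly p 0 = c" by (simp add: p_def a_def)
    fix z assume z: "z \<in> K"
    then have "z \<noteq> 0" using assms by auto
    have "norm (a * (1 - z * poly q z)) = norm a * (norm z * norm (1 / z - poly q z))"
      using \<open>z \<noteq> 0\<close> by (simp add: norm_mult[symmetric] right_diff_distrib)
    also have "\<dots> \<le> (norm a + 1) * (R * d)"
      using q[OF z] R z by (intro mult_mono) (auto intro: less_imp_le)
    also have "\<dots> = e / 2"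
    proof -
      have "R * (norm a + 1) \<noteq> 0"
        using R(1) add_nonneg_pos[OF norm_ge_zero[of a] zero_less_one] by simp
      moreover have "(norm a + 1) * (R * d) = (R * (norm a + 1)) * d" by simp
      ultimately show ?thesis unfolding d_def by (metis nonzero_mult_div_cancel_left times_divide_eq_right)
    qed
    finally have small: "norm (a * (1 - z * poly q z)) \<le> e / 2" .
    have "dist (g z) (poly p z) = norm ((g z - poly p0 z) - a * (1 - z * poly q z))"
      by (simp add: p_def dist_norm algebra_simps)
    also have "\<dots> \<le> norm (g z - poly p0 z) + norm (a * (1 - z * poly q z))"
      by (rule norm_triangle_ineq4)
    also have "\<dots> < e" using p0[OF z] small by linarith
    finally show "dist (g z) (poly p z) < e" .
  qed
qed

subsection \<open>The Baire argument\<close>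

text \<open>Baire's theorem for \<open>Hol \<Omega>\<close>, with density expressed by basic
  neighbourhoods. A sequence of such neighbourhoods is built whose centres converge locally
  uniformly to a function lying in all of them.\<close>

lemma Hol_Baire:
  fixes U :: "nat \<Rightarrow> (complex \<Rightarrow> complex) set"
  assumes "open \<Omega>" and op: "\<And>n. openin (Hol_topology \<Omega>) (U n)"
    and dense: "\<And>n g K e. \<lbrakk>g \<in> Hol \<Omega>; compact K; K \<subseteq> \<Omega>; e > 0\<rbrakk> \<Longrightarrow>
      \<exists>f\<in>U n. \<forall>z\<in>K. dist (g z) (f z) < e"
    and g: "g \<in> Hol \<Omega>" and K: "compact K" "K \<subseteq> \<Omega>" and "e > 0"
  obtains F where "F \<in> (\<Inter>n. U n)" "\<And>z. z \<in> K \<Longrightarrow> dist (g z) (F z) < e"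
proof -
  obtain C :: "nat \<Rightarrow> complex set" where C: "\<And>n. compact (C n)" "\<And>n. C n \<subseteq> \<Omega>"
    and exh: "\<And>L. \<lbrakk>compact L; L \<subseteq> \<Omega>\<rbrakk> \<Longrightarrow> \<exists>N. \<forall>n\<ge>N. L \<subseteq> C n"
    using open_Union_compact_subsets[OF assms(1)] by metis
  define nb where "nb f L d = {h \<in> Hol \<Omega>. \<forall>z\<in>L. dist (f z) (h z) < d}"
    for f :: "complex \<Rightarrow> complex" and L and d :: real
  \<comment> \<open>A state \<open>(f, L, d)\<close> stands for the neighbourhood
    \<open>nb f L d\<close>. The sets \<open>L\<close> exhaust \<open>\<Omega>\<close> along with
    \<open>C\<close>, the radii tend to 0, and the initial state keeps the limit within
    \<open>e\<close> of \<open>g\<close> on \<open>K\<close>.\<close>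
  define P where "P n x \<longleftrightarrow> (case x of (f, L, d) \<Rightarrow> f \<in> Hol \<Omega> \<and> compact L \<and> L \<subseteq> \<Omega> \<and> C n \<subseteq> L \<and>
      0 < d \<and> d \<le> (1/2) ^ n \<and> (n = 0 \<longrightarrow> f = g \<and> K \<subseteq> L \<and> d \<le> e))" for n :: nat and x
  \<comment> \<open>Stage \<open>n\<close> takes care of \<open>U n\<close>. Moving the centre by
    less than \<open>d / 4\<close> while at least halving the radius keeps the total later
    displacement on \<open>L\<close> at most \<open>d / 2\<close>.\<close>
  define Q where "Q n x y \<longleftrightarrow> (case x of (f, L, d) \<Rightarrow> case y of (f', L', d') \<Rightarrow>
      nb f' L' d' \<subseteq> U n \<and> L \<subseteq> L' \<and> (\<forall>z\<in>L. dist (f z) (f' z) < d / 4) \<and> d' \<le> d / 2)" for n :: nat and x y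
  have "\<exists>s. \<forall>n. P n (s n) \<and> Q n (s n) (s (Suc n))"
  proof (rule dependent_nat_choice)
    have "P 0 (g, K \<union> C 0, min e 1)"
      using g K C \<open>e > 0\<close> by (auto simp: P_def)
    then show "\<exists>x. P 0 x" ..
  next
    fix x n assume Px: "P n x"
    obtain f L d where x: "x = (f, L, d)" by (cases x)
    have f: "f \<in> Hol \<Omega>" "compact L" "L \<subseteq> \<Omega>" "0 < d" "d \<le> (1/2) ^ n"
      using Px by (auto simp: P_def x)
    then obtain f' where f': "f' \<in> U n" "\<forall>z\<in>L. dist (f z) (f' z) < d / 4"
      using dense[of f L "d / 4" n] by auto
    have "f' \<in> Hol \<Omega>" using op[of n] f'(1) by (auto simp: openin_Hol_topology)
    obtain L1 d1 where L1: "compact L1" "L1 \<subseteq> \<Omega>" "d1 > 0" "nb f' L1 d1 \<subseteq> U n"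
      using op[of n] f'(1) unfolding openin_Hol_topology nb_def by blast
    define y where "y = (f', L \<union> L1 \<union> C (Suc n), min d1 (d / 2))"
    have "nb f' (L \<union> L1 \<union> C (Suc n)) (min d1 (d / 2)) \<subseteq> nb f' L1 d1"
      by (auto simp: nb_def)
    then have "Q n x y" using L1(4) f'(2) by (auto simp: Q_def x y_def)
    moreover have "P (Suc n) y"
      using \<open>f' \<in> Hol \<Omega>\<close> L1 C f by (auto simp: P_def y_def min_le_iff_disj)
    ultimately show "\<exists>y. P (Suc n) y \<and> Q n x y" by blast
  qed
  then obtain s where s: "\<And>n. P n (s n)" "\<And>n. Q n (s n) (s (Suc n))" by blast
  define f where "f n = fst (s n)" for n
  define L where "L n = fst (snd (s n))" for n
  define d where "d n = snd (snd (s n))" for n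
  have s_eq: "s n = (f n, L n, d n)" for n by (simp add: f_def L_def d_def)
  have f: "f n \<in> Hol \<Omega>" "L n \<subseteq> \<Omega>" "C n \<subseteq> L n" "0 < d n" "d n \<le> (1/2) ^ n" for n
    using s(1)[of n] by (auto simp: P_def s_eq)
  have start: "f 0 = g" "K \<subseteq> L 0" "d 0 \<le> e"
    using s(1)[of 0] by (auto simp: P_def s_eq)
  have step: "nb (f (Suc n)) (L (Suc n)) (d (Suc n)) \<subseteq> U n" "L n \<subseteq> L (Suc n)"
    "\<And>z. z \<in> L n \<Longrightarrow> dist (f n z) (f (Suc n) z) < d n / 4" "d (Suc n) \<le> d n / 2" for n
    using s(2)[of n] by (auto simp: Q_def s_eq)
  have mono: "L m \<subseteq> L n" if "m \<le> n" for m n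
    using step(2) that by (rule lift_Suc_mono_le)
  \<comment> \<open>The sum telescopes because \<open>d (Suc m) \<le> d m / 2\<close> gives
    \<open>d m / 4 \<le> (d m - d (Suc m)) / 2\<close>.\<close>
  have telescope: "dist (f n z) (f (n + k) z) \<le> (d n - d (n + k)) / 2" if "z \<in> L n" for n k z
  proof (induction k)
    case (Suc k)
    have "z \<in> L (n + k)" using mono[of n "n + k"] that by auto
    from step(3)[OF this] step(4)[of "n + k"] Suc
      dist_triangle[of "f n z" "f (n + Suc k) z" "f (n + k) z"]
    show ?case by simp
  qed simp
  have close: "dist (f n z) (f m z) \<le> d n / 2" if "z \<in> L n" "n \<le> m" for n m z
    using telescope[OF that(1), of "m - n"] f(4)[of m] that(2) by simp
  define F where "F = restrict (\<lambda>z. lim (\<lambda>n. f n z)) \<Omega>"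
  have limF: "(\<lambda>n. f n z) \<longlonglongrightarrow> F z" if "z \<in> L N" for z N
  proof -
    have "Cauchy (\<lambda>n. f n z)"
      unfolding Cauchy_altdef
    proof (intro allI impI)
      fix \<epsilon> :: real assume "\<epsilon> > 0"
      then obtain M where M: "(1/2) ^ M < \<epsilon>"
        using real_arch_pow_inv[of \<epsilon> "1/2"] by auto
      show "\<exists>M. \<forall>m\<ge>M. \<forall>n>m. dist (f m z) (f n z) < \<epsilon>"
      proof (intro exI[of _ "max N M"] allI impI)
        fix m n :: nat assume m: "max N M \<le> m" and n: "m < n"
        have "dist (f m z) (f n z) \<le> d m / 2"
          using mono[of N m] that m n by (intro close) auto
        also have "\<dots> \<le> (1/2) ^ m" using f(4,5)[of m] by simp
        also have "\<dots> \<le> (1/2) ^ M" using m by (intro power_decreasing) auto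
        finally show "dist (f m z) (f n z) < \<epsilon>" using M by simp
      qed
    qed
    then have "(\<lambda>n. f n z) \<longlonglongrightarrow> lim (\<lambda>n. f n z)"
      by (simp add: Cauchy_convergent_iff convergent_LIMSEQ_iff)
    then show ?thesis using that f(2) by (auto simp: F_def)
  qed
  have closeF: "dist (f n z) (F z) \<le> d n / 2" if "z \<in> L n" for n z
  proof (rule tendsto_upperbound)
    show "(\<lambda>m. dist (f n z) (f m z)) \<longlonglongrightarrow> dist (f n z) (F z)"
      by (intro tendsto_intros limF[OF that])
    show "\<forall>\<^sub>F m in sequentially. dist (f n z) (f m z) \<le> d n / 2"
      using eventually_ge_at_top[of n] by eventually_elim (rule close[OF that])
  qed simp
  have "F holomorphic_on \<Omega>"
  proof (rule holomorphic_uniform_sequence[OF assms(1)])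
    show "f n holomorphic_on \<Omega>" for n using f(1)[of n] by (simp add: Hol_def)
    fix x assume "x \<in> \<Omega>"
    then obtain r where r: "r > 0" "cball x r \<subseteq> \<Omega>"
      using assms(1) open_contains_cball by blast
    then obtain N where N: "\<And>n. n \<ge> N \<Longrightarrow> cball x r \<subseteq> C n" using exh[of "cball x r"] by auto
    have "uniform_limit (cball x r) f F sequentially"
    proof (rule uniform_limitI)
      fix \<epsilon> :: real assume "\<epsilon> > 0"
      then obtain M where M: "(1/2) ^ M < \<epsilon>"
        using real_arch_pow_inv[of \<epsilon> "1/2"] by auto
      show "\<forall>\<^sub>F n in sequentially. \<forall>z\<in>cball x r. dist (f n z) (F z) < \<epsilon>"
        using eventually_ge_at_top[of "max N M"]
      proof eventually_elim
        fix n assume n: "max N M \<le> n"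
        show "\<forall>z\<in>cball x r. dist (f n z) (F z) < \<epsilon>"
        proof
          fix z assume "z \<in> cball x r"
          then have "dist (f n z) (F z) \<le> d n / 2" using closeF N f(3) n by (meson max.boundedE subsetD)
          also have "\<dots> \<le> (1/2) ^ n" using f(4,5)[of n] by simp
          also have "\<dots> \<le> (1/2) ^ M" using n by (intro power_decreasing) auto
          finally show "dist (f n z) (F z) < \<epsilon>" using M by simp
        qed
      qed
    qed
    with r show "\<exists>r>0. cball x r \<subseteq> \<Omega> \<and> uniform_limit (cball x r) f F sequentially" by blast
  qed
  then have FHol: "F \<in> Hol \<Omega>" by (simp add: Hol_def F_def)
  \<comment> \<open>The limit only inherits a non-strict bound; having \<open>d n / 2\<close> there
    rather than \<open>d n\<close> gives the strict inequality that membership in \<open>nb\<close>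
    requires.\<close>
  have near: "dist (f n z) (F z) < d n" if "z \<in> L n" for n z
    using closeF[OF that] f(4)[of n] by simp
  show thesis
  proof (rule that)
    have "F \<in> nb (f (Suc n)) (L (Suc n)) (d (Suc n))" for n
      using FHol near by (simp add: nb_def)
    then show "F \<in> (\<Inter>n. U n)" using step(1) by blast
    show "dist (g z) (F z) < e" if "z \<in> K" for z
      using near[of z 0] start that by auto
  qed
qed

section \<open>A countable intersection of dense open sets inside
  \<open>S_t \<Omega>\<close>\<close>

theorem theorem4p7:
  fixes \<Omega> :: "complex set"
  assumes "open \<Omega>" and "connected \<Omega>" and "simply_connected \<Omega>" and "0 \<notin> \<Omega>"
  shows "\<exists>G. gdelta_in (Hol_topology \<Omega>) G \<and>
             Hol_topology \<Omega> closure_of G = Hol \<Omega> \<and>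
             G \<subseteq> S_t \<Omega>"
proof -
  obtain C :: "nat \<Rightarrow> complex set" where C: "\<And>n. compact (C n)" "\<And>n. C n \<subseteq> \<Omega>"
    and exh: "\<And>L. \<lbrakk>compact L; L \<subseteq> \<Omega>\<rbrakk> \<Longrightarrow> \<exists>N. \<forall>n\<ge>N. L \<subseteq> C n"
    using open_Union_compact_subsets[OF assms(1)] by metis
  \<comment> \<open>Targets from a countable dense set suffice, since an arbitrary \<open>c\<close>
    is approximated by them at each stage.\<close>
  obtain D :: "complex set" where D: "countable D" "\<And>X. open X \<Longrightarrow> X \<noteq> {} \<Longrightarrow> \<exists>d\<in>D. d \<in> X"
    using countable_dense_setE by blast
  have "D \<noteq> {}" using D(2)[of UNIV] by auto
  define q where "q = from_nat_into D"
  have q: "range q = D" using D(1) \<open>D \<noteq> {}\<close> by (simp add: q_def range_from_nat_into)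
  \<comment> \<open>The bound \<open>\<epsilon>\<close> lies strictly below
    \<open>1 / real (Suc m)\<close>, uniformly on \<open>C m\<close>. This leaves the room for
    perturbation that openness needs.\<close>
  define V where "V m j = {f \<in> Hol \<Omega>. \<exists>N. \<exists>\<epsilon> < 1 / real (Suc m). \<forall>z\<in>C m. dist (T_tilde \<Omega> N f z) (q j) \<le> \<epsilon>}"
    for m j :: nat
  define U where "U k = (case prod_decode k of (m, j) \<Rightarrow> V m j)" for k
  have UV: "(\<Inter>k. U k) \<subseteq> V m j" for m j
    using INT_lower[of "prod_encode (m, j)" UNIV U] by (simp add: U_def)
  have openV: "openin (Hol_topology \<Omega>) (V m j)" for m j
    unfolding openin_Hol_topology
  proof (intro conjI ballI)
    show "V m j \<subseteq> Hol \<Omega>" by (auto simp: V_def)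
    fix f assume "f \<in> V m j"
    then obtain N \<epsilon> where f: "f \<in> Hol \<Omega>" "\<epsilon> < 1 / real (Suc m)"
      "\<And>z. z \<in> C m \<Longrightarrow> dist (T_tilde \<Omega> N f z) (q j) \<le> \<epsilon>"
      by (auto simp: V_def)
    obtain \<eta> where "\<epsilon> < \<eta>" "\<eta> < 1 / real (Suc m)"
      using dense[OF f(2)] by blast
    \<comment> \<open>A function near \<open>f\<close> satisfies the estimate with
      \<open>\<epsilon> + \<delta>\<close>, which must again be strictly below the
      threshold.\<close>
    define \<delta> where "\<delta> = \<eta> - \<epsilon>"
    have \<delta>: "\<delta> > 0" "\<epsilon> + \<delta> < 1 / real (Suc m)"
      using \<open>\<epsilon> < \<eta>\<close> \<open>\<eta> < 1 / real (Suc m)\<close> by (simp_all add: \<delta>_def)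
    obtain L d where L: "compact L" "L \<subseteq> \<Omega>" "d > 0"
      and close: "\<And>f g z. \<lbrakk>f \<in> Hol \<Omega>; g \<in> Hol \<Omega>; \<And>z. z \<in> L \<Longrightarrow> dist (f z) (g z) < d; z \<in> C m\<rbrakk> \<Longrightarrow>
        dist (T_tilde \<Omega> N f z) (T_tilde \<Omega> N g z) < \<delta>"
      using T_tilde_continuous[OF assms(1) C(1) C(2) \<delta>(1)] by metis
    have "{g \<in> Hol \<Omega>. \<forall>z\<in>L. dist (f z) (g z) < d} \<subseteq> V m j"
    proof clarify
      fix g assume g: "g \<in> Hol \<Omega>" "\<forall>z\<in>L. dist (f z) (g z) < d"
      have "dist (T_tilde \<Omega> N g z) (q j) \<le> \<epsilon> + \<delta>" if "z \<in> C m" for z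
        using close[OF f(1) g(1) _ that] g(2) f(3)[OF that]
          dist_triangle3[of "T_tilde \<Omega> N g z" "q j" "T_tilde \<Omega> N f z"] by auto
      then show "g \<in> V m j" using g(1) \<delta>(2) unfolding V_def by blast
    qed
    with L show "\<exists>K e. compact K \<and> K \<subseteq> \<Omega> \<and> 0 < e \<and> {g \<in> Hol \<Omega>. \<forall>z\<in>K. dist (f z) (g z) < e} \<subseteq> V m j"
      by blast
  qed
  have denseV: "\<exists>f\<in>V m j. \<forall>z\<in>K. dist (g z) (f z) < e"
    if hyps: "g \<in> Hol \<Omega>" "compact K" "K \<subseteq> \<Omega>" "e > 0" for m j g K e
  proof -
    \<comment> \<open>The prescribed value \<open>q j\<close> at 0 makes the transform of order
      \<open>degree p\<close> constantly \<open>q j\<close> on \<open>\<Omega>\<close>, so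
      membership in \<open>V m j\<close> holds with error bound 0.\<close>
    obtain p where p: "poly p 0 = q j" "\<And>z. z \<in> K \<Longrightarrow> dist (g z) (poly p z) < e"
      using Hol_poly_approx_value_at_0[OF assms(1,3,4) hyps] by metis
    define f where "f = restrict (poly p) \<Omega>"
    have "poly p holomorphic_on \<Omega>" by (intro holomorphic_intros)
    then have "f holomorphic_on \<Omega>"
      by (rule holomorphic_transform) (simp add: f_def)
    then have f: "f \<in> Hol \<Omega>" by (simp add: Hol_def f_def)
    have "T_tilde \<Omega> (degree p) f z = q j" if "z \<in> C m" for z
      using T_tilde_poly[OF assms(1) _ order_refl f, of z p] C(2)[of m] that p(1)
      by (auto simp: f_def)
    then have "\<forall>z\<in>C m. dist (T_tilde \<Omega> (degree p) f z) (q j) \<le> 0" by simp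
    moreover have "0 < 1 / real (Suc m)" by simp
    ultimately have "f \<in> V m j" using f unfolding V_def by blast
    moreover have "\<forall>z\<in>K. dist (g z) (f z) < e"
      using p(2) hyps(3) by (auto simp: f_def)
    ultimately show ?thesis by blast
  qed
  have openU: "openin (Hol_topology \<Omega>) (U k)" for k
    using openV by (simp add: U_def split: prod.split)
  have denseU: "\<exists>f\<in>U k. \<forall>z\<in>K. dist (g z) (f z) < e"
    if "g \<in> Hol \<Omega>" "compact K" "K \<subseteq> \<Omega>" "e > 0" for k g K e
    using denseV[OF that] by (simp add: U_def split: prod.split)
  show ?thesis
  proof (intro exI conjI)
    show "gdelta_in (Hol_topology \<Omega>) (\<Inter>k. U k)"
      using openU by (intro gdelta_in_Inter) (auto intro: open_imp_gdelta_in)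
    show "Hol_topology \<Omega> closure_of (\<Inter>k. U k) = Hol \<Omega>"
    proof
      show "Hol_topology \<Omega> closure_of (\<Inter>k. U k) \<subseteq> Hol \<Omega>"
        using closure_of_subset_topspace[of "Hol_topology \<Omega>"] by simp
      show "Hol \<Omega> \<subseteq> Hol_topology \<Omega> closure_of (\<Inter>k. U k)"
      proof
        fix g assume g: "g \<in> Hol \<Omega>"
        have "\<exists>F\<in>\<Inter>k. U k. F \<in> T" if "g \<in> T" and T: "openin (Hol_topology \<Omega>) T" for T
        proof -
          obtain K e where K: "compact K" "K \<subseteq> \<Omega>" "e > 0"
            and sub: "{h \<in> Hol \<Omega>. \<forall>z\<in>K. dist (g z) (h z) < e} \<subseteq> T"
            using T \<open>g \<in> T\<close> unfolding openin_Hol_topology by blast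
          obtain F where F: "F \<in> (\<Inter>k. U k)" "\<And>z. z \<in> K \<Longrightarrow> dist (g z) (F z) < e"
            using Hol_Baire[of \<Omega> U g K e, OF assms(1) openU denseU g K] by blast
          have "F \<in> Hol \<Omega>" using F(1) openU[of 0] by (auto simp: openin_Hol_topology)
          then have "F \<in> T" using F(2) by (intro subsetD[OF sub]) simp
          then show ?thesis using F(1) by (rule bexI)
        qed
        then show "g \<in> Hol_topology \<Omega> closure_of (\<Inter>k. U k)"
          using g unfolding in_closure_of topspace_Hol_topology by blast
      qed
    qed
    show "(\<Inter>k. U k) \<subseteq> S_t \<Omega>"
    proof
      fix f assume "f \<in> (\<Inter>k. U k)"
      then have f: "f \<in> V m j" for m j using UV by blast
      have "\<exists>l. \<forall>L. compact L \<and> L \<subseteq> \<Omega> \<longrightarrow>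
          uniform_limit L (\<lambda>n. T_tilde \<Omega> (l n) f) (\<lambda>_. c) sequentially" for c
      proof -
        \<comment> \<open>One error \<open>1 / real (Suc n)\<close> comes from replacing
          \<open>c\<close> by a nearby \<open>q j\<close>, the other from membership of
          \<open>f\<close> in \<open>V n j\<close>.\<close>
        have "\<exists>N. \<forall>z\<in>C n. dist (T_tilde \<Omega> N f z) c < 2 / real (Suc n)" for n
        proof -
          obtain j where j: "dist c (q j) < 1 / real (Suc n)"
            using D(2)[of "ball c (1 / real (Suc n))"] q by (auto simp del: of_nat_Suc)
          obtain N \<epsilon> where N: "\<epsilon> < 1 / real (Suc n)" "\<And>z. z \<in> C n \<Longrightarrow> dist (T_tilde \<Omega> N f z) (q j) \<le> \<epsilon>"
            using f[of n j] by (auto simp: V_def)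
          have "dist (T_tilde \<Omega> N f z) c < 2 / real (Suc n)" if "z \<in> C n" for z
          proof -
            have "dist (T_tilde \<Omega> N f z) c < 1 / real (Suc n) + 1 / real (Suc n)"
              using dist_triangle2[of "T_tilde \<Omega> N f z" c "q j"] N(2)[OF that] N(1) j by linarith
            then show ?thesis by simp
          qed
          then show ?thesis by blast
        qed
        then obtain l where l: "\<And>n z. z \<in> C n \<Longrightarrow> dist (T_tilde \<Omega> (l n) f z) c < 2 / real (Suc n)"
          by metis
        \<comment> \<open>The sequence \<open>l\<close> was chosen from the exhaustion alone. It
          serves every compact \<open>L\<close>, because \<open>L\<close> lies in \<open>C n\<close>
          for all large \<open>n\<close>.\<close>
        have "uniform_limit L (\<lambda>n. T_tilde \<Omega> (l n) f) (\<lambda>_. c) sequentially"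
          if L: "compact L" "L \<subseteq> \<Omega>" for L
        proof (rule uniform_limitI)
          fix e :: real assume "e > 0"
          obtain N where N: "\<And>n. n \<ge> N \<Longrightarrow> L \<subseteq> C n" using exh[OF L] by blast
          have "(\<lambda>n. 2 / real (Suc n)) \<longlonglongrightarrow> 0"
            using tendsto_mult_right_zero[OF LIMSEQ_inverse_real_of_nat, of 2] by (simp add: field_simps)
          then have "\<forall>\<^sub>F n in sequentially. 2 / real (Suc n) < e"
            using \<open>e > 0\<close> by (rule order_tendstoD(2))
          then show "\<forall>\<^sub>F n in sequentially. \<forall>z\<in>L. dist (T_tilde \<Omega> (l n) f z) c < e"
            using eventually_ge_at_top[of N]
          proof eventually_elim
            case (elim n)
            then show ?case using l N by (meson less_trans subsetD)
          qed
        qed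
        then show ?thesis by blast
      qed
      moreover have "f \<in> Hol \<Omega>" using f by (simp add: V_def)
      ultimately show "f \<in> S_t \<Omega>" by (simp add: S_t_def)
    qed
  qed
qed

end
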